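(* Let $\mathcal{G}\subset O(3)$ be a discrete (hence finite) subgroup and let $r_0$ be the support function of a surface of constant width $w$ in $\mathbb{E}^3$. Then the surface determined by the support function $$r(\xi,\bar\xi)=\frac{1}{\#\mathcal{G}}\sum_{g\in\mathcal{G}} r_0\big(g(\xi),g(\bar\xi)\big)$$ is a surface of constant width $w$ which is invariant under $\mathcal{G}$.
   Context: The support function $r:S^2\to\mathbb{R}$ of a closed convex surface $S\subset\mathbb{E}^3$ gives the (signed) distance from the origin to the tangent plane of $S$ with a given outward unit normal direction; directions in $S^2$ are described by the stereographic coordinate $\xi=\tan(\theta/2)e^{i\phi}$ (projection from the south pole). With $\tau(\xi)=-1/\bar\xi$ the antipodal map, $S$ has constant width $w$ if $r+r\circ\tau\equiv w$. Elements $g\in O(3)$ act on $S^2$ as isometries, and $r_0(g(\xi),g(\bar\xi))$ denotes the value of $r_0$ at the image under $g$ of the direction with coordinate $\xi$. $\#\mathcal{G}$ is the order of $\mathcal{G}$. *)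

theory Defs
  imports "HOL-Analysis.Analysis" "HOL-Algebra.Group"
begin

definition O3 :: "(real^3^3) monoid" where
  "O3 = \<lparr>carrier = {A. orthogonal_matrix A}, mult = (**), one = mat 1\<rparr>"

lemma group_O3: "group O3"
proof (rule groupI)
  fix A assume "A \<in> carrier O3"
  then show "\<exists>B \<in> carrier O3. B \<otimes>\<^bsub>O3\<^esub> A = \<one>\<^bsub>O3\<^esub>"
    by (intro bexI[of _ "transpose A"]) (auto simp: O3_def orthogonal_matrix_def)
qed (auto simp: O3_def orthogonal_matrix_mul orthogonal_matrix_id matrix_mul_assoc)

text \<open>No smoothness is required, so a tangent plane means a supporting plane.\<close>

definition closed_convex_surface :: "(real^3) set \<Rightarrow> bool" where
  "closed_convex_surface S \<longleftrightarrow>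
     (\<exists>K. compact K \<and> convex K \<and> interior K \<noteq> {} \<and> S = frontier K)"

definition support_function :: "(real^3) set \<Rightarrow> real^3 \<Rightarrow> real" where
  "support_function S u = (SUP x\<in>S. x \<bullet> u)"

text \<open>For a unit vector \<open>u\<close>, the value \<open>support_function S u\<close> is the signed distance from the
  origin to the tangent plane of \<open>S\<close> with outward normal \<open>u\<close>:\<close>

lemma support_function_tangent_plane:
  assumes "closed_convex_surface S"
  shows "support_function S u = c \<longleftrightarrow>
           S \<subseteq> {x. x \<bullet> u \<le> c} \<and> S \<inter> {x. x \<bullet> u = c} \<noteq> {}"
proof -
  from assms obtain K where K: "compact K" "interior K \<noteq> {}" "S = frontier K"
    unfolding closed_convex_surface_def by blast
  then have "compact S"
    by (simp add: compact_frontier)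
  have "K \<noteq> UNIV"
    using K(1) compact_imp_bounded not_bounded_UNIV by blast
  then have "S \<noteq> {}"
    using K frontier_eq_empty[of K] by auto
  have "compact ((\<lambda>x. x \<bullet> u) ` S)"
    by (intro compact_continuous_image continuous_intros \<open>compact S\<close>)
  then obtain x where x: "x \<in> S" "\<And>y. y \<in> S \<Longrightarrow> y \<bullet> u \<le> x \<bullet> u"
    using compact_attains_sup[of "(\<lambda>x. x \<bullet> u) ` S"] \<open>S \<noteq> {}\<close> by auto
  then have "support_function S u = x \<bullet> u"
    unfolding support_function_def by (intro cSup_eq_maximum) auto
  with x show ?thesis
    by (auto intro: antisym)
qed

text \<open>A support function is only considered on the unit sphere; its values elsewhere are
  irrelevant.\<close>

definition has_support_function :: "(real^3) set \<Rightarrow> (real^3 \<Rightarrow> real) \<Rightarrow> bool" where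
  "has_support_function S r \<longleftrightarrow>
     closed_convex_surface S \<and> (\<forall>u\<in>sphere 0 1. r u = support_function S u)"

definition constant_width :: "(real^3) set \<Rightarrow> real \<Rightarrow> bool" where
  "constant_width S w \<longleftrightarrow>
     closed_convex_surface S \<and>
     (\<forall>u\<in>sphere 0 1. support_function S u + support_function S (- u) = w)"

definition invariant_under :: "(real^3^3) set \<Rightarrow> (real^3) set \<Rightarrow> bool" where
  "invariant_under G S \<longleftrightarrow> (\<forall>g\<in>G. (\<lambda>x. g *v x) ` S = S)"

end

theory Submission
  imports Defs
begin

text \<open>
  On convex bodies, forming the support function turns Minkowski addition and positive scaling
  into addition and scaling of functions, and turns the image under an orthogonal matrix into
  precomposition with its transpose.  The averaged function is therefore the support function of
  the Minkowski average of the bodies \<open>g\<inverse> K\<close> for \<open>g \<in> G\<close>, where \<open>K\<close> is the body bounded by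
  the given surface; so a closed convex surface with this support function exists
  (\<open>convex_body_support_sum\<close>, \<open>convex_body_support_scale\<close>, \<open>convex_body_support_orthogonal\<close>).
  By separation a convex body is the intersection of its supporting half-spaces, which gives
  uniqueness (\<open>has_support_function_unique\<close>).

  The width condition is affine in the support function and holds for each summand, because an
  orthogonal map commutes with the antipodal map.  For invariance, \<open>h S\<close> has support function
  \<open>u \<mapsto> r (h\<inverse> u)\<close>; reindexing the average by the right translation \<open>g \<mapsto> g h\<inverse>\<close> shows that
  this is again \<open>r\<close>, so \<open>h S = S\<close> by uniqueness.

  Finiteness of \<open>G\<close> comes from the Euclidean norm on matrices: it is invariant under right
  multiplication by orthogonal matrices.  Hence an isolation radius at the identity serves at
  every element, and a bounded set with a uniform isolation radius is finite.
\<close>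

section \<open>Discrete groups of orthogonal matrices\<close>

lemma inner_matrix_vector_transpose:
  fixes A :: "real^'n^'n"
  shows "(A *v x) \<bullet> u = x \<bullet> (transpose A *v u)"
  using dot_lmul_matrix[of u A x] by (simp add: inner_commute transpose_matrix_vector)

lemma norm_orthogonal_matrix_vector:
  fixes A :: "real^'n^'n"
  assumes "orthogonal_matrix A"
  shows "norm (A *v x) = norm x"
  using assms
  by (simp add: norm_eq_sqrt_inner inner_matrix_vector_transpose matrix_vector_mul_assoc orthogonal_matrix_def)

text \<open>The rows of \<open>B ** A\<close> are the images of the rows of \<open>B\<close> under \<open>transpose A\<close>.\<close>

lemma norm_matrix_mult_orthogonal:
  fixes A B :: "real^'n^'n"
  assumes "orthogonal_matrix A"
  shows "norm (B ** A) = norm B"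
proof -
  have "(B ** A) $ i = transpose A *v (B $ i)" for i
    by (simp add: vec_eq_iff matrix_matrix_mult_def matrix_vector_mult_def transpose_def mult.commute)
  then show ?thesis
    using norm_orthogonal_matrix_vector[of "transpose A"] assms
    by (simp add: norm_vec_def)
qed

lemma dist_matrix_mult_orthogonal:
  fixes A B C :: "real^'n^'n"
  assumes "orthogonal_matrix A"
  shows "dist (B ** A) (C ** A) = dist B C"
proof -
  have "B ** A - C ** A = (B - C) ** A"
    by (simp add: vec_eq_iff matrix_matrix_mult_def left_diff_distrib sum_subtractf)
  then show ?thesis
    using norm_matrix_mult_orthogonal[OF assms] by (simp add: dist_norm)
qed

lemma subgroup_O3D:
  assumes "subgroup G O3"
  shows "mat 1 \<in> G"
    and "g \<in> G \<Longrightarrow> orthogonal_matrix g"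
    and "g \<in> G \<Longrightarrow> h \<in> G \<Longrightarrow> g ** h \<in> G"
    and "g \<in> G \<Longrightarrow> transpose g \<in> G"
proof -
  interpret group O3 by (rule group_O3)
  show "mat 1 \<in> G"
    using subgroup.one_closed[OF assms] by (simp add: O3_def)
  show orth: "orthogonal_matrix g" if "g \<in> G" for g
    using subgroup.mem_carrier[OF assms that] by (simp add: O3_def)
  show "g ** h \<in> G" if "g \<in> G" "h \<in> G"
    using subgroup.m_closed[OF assms that] by (simp add: O3_def)
  show "transpose g \<in> G" if "g \<in> G"
  proof -
    have "inv\<^bsub>O3\<^esub> g = transpose g"
      using orth[OF that]
      by (intro inv_equality) (auto simp: O3_def orthogonal_matrix_def)
    then show ?thesis
      using subgroup.m_inv_closed[OF assms that] by simp
  qed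
qed

text \<open>Right translation by \<open>transpose g\<close>, the inverse of \<open>g\<close>, is an isometry taking \<open>g\<close> to the
  identity, so any element close to \<open>g\<close> becomes one close to the identity.\<close>

lemma finite_discrete_subgroup_O3:
  assumes G: "subgroup G O3" and "discrete G"
  shows "finite G"
proof -
  obtain e where e: "e > 0" "\<And>g. g \<in> G \<Longrightarrow> dist (mat 1) g < e \<Longrightarrow> g = mat 1"
    using discreteD[OF \<open>discrete G\<close> subgroup_O3D(1)[OF G]]
    by (auto simp: isolated_in_dist_Ex_iff)
  have "uniform_discrete G"
  proof (rule uniformI1[OF e(1)])
    fix g h assume gh: "g \<in> G" "h \<in> G" "dist g h < e"
    have orth: "orthogonal_matrix g" "orthogonal_matrix (transpose g)"
      using subgroup_O3D(2)[OF G gh(1)] by simp_all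
    have "dist (g ** transpose g) (h ** transpose g) < e"
      using gh(3) dist_matrix_mult_orthogonal[OF orth(2)] by simp
    moreover have "h ** transpose g \<in> G"
      using gh G by (simp add: subgroup_O3D)
    ultimately have "h ** transpose g = mat 1"
      using e(2) orth(1) by (simp add: orthogonal_matrix_def)
    then have "(h ** transpose g) ** g = g" by simp
    then show "g = h"
      using orth(1) by (simp add: orthogonal_matrix_def flip: matrix_mul_assoc)
  qed
  moreover have "bounded G"
  proof -
    have "norm g = norm (mat 1 :: real^3^3)" if "g \<in> G" for g
      using norm_matrix_mult_orthogonal[of g "mat 1"] subgroup_O3D(2)[OF G that] by simp
    then show ?thesis
      by (intro boundedI[of _ "norm (mat 1 :: real^3^3)"]) simp
  qed
  ultimately show ?thesis
    by (simp flip: uniform_discrete_finite_iff)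
qed

section \<open>Support functions of convex bodies\<close>

text \<open>Requiring the supremum to be attained loses nothing by compactness, and it makes the calculus
  of support functions below a matter of moving the touching point.\<close>

definition convex_body_support :: "'a::euclidean_space set \<Rightarrow> ('a \<Rightarrow> real) \<Rightarrow> bool" where
  "convex_body_support K h \<longleftrightarrow>
     compact K \<and> convex K \<and> interior K \<noteq> {} \<and>
     (\<forall>u\<in>sphere 0 1. (\<forall>x\<in>K. x \<bullet> u \<le> h u) \<and> (\<exists>x\<in>K. x \<bullet> u = h u))"

text \<open>A linear functional is maximised on a Minkowski sum by maximising it on each summand.  The sum
  has interior points because it contains a translate of the first body.\<close>

lemma convex_body_support_add:
  assumes K: "convex_body_support K h" and L: "convex_body_support L k"
  shows "convex_body_support (\<Union>x\<in>K. \<Union>y\<in>L. {x + y}) (\<lambda>u. h u + k u)"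
    (is "convex_body_support ?M _")
proof -
  have "compact ?M" "convex ?M"
    using K L compact_sums' convex_sums
    by (auto simp: convex_body_support_def)
  moreover have "interior ?M \<noteq> {}"
  proof -
    obtain y where "y \<in> L"
      using L interior_subset by (fastforce simp: convex_body_support_def)
    then have "(+) y ` K \<subseteq> ?M"
      by (auto simp: add.commute)
    then have "(+) y ` interior K \<subseteq> interior ?M"
      using interior_mono[of "(+) y ` K"] by (simp add: interior_translation)
    then show ?thesis
      using K by (auto simp: convex_body_support_def)
  qed
  moreover have "(\<forall>z\<in>?M. z \<bullet> u \<le> h u + k u) \<and> (\<exists>z\<in>?M. z \<bullet> u = h u + k u)"
    if u: "u \<in> sphere 0 1" for u
  proof
    show "\<forall>z\<in>?M. z \<bullet> u \<le> h u + k u"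
      using K L u by (auto simp: convex_body_support_def inner_add_left intro!: add_mono)
    obtain x y where "x \<in> K" "x \<bullet> u = h u" "y \<in> L" "y \<bullet> u = k u"
      using K L u unfolding convex_body_support_def by blast
    then show "\<exists>z\<in>?M. z \<bullet> u = h u + k u"
      by (intro bexI[of _ "x + y"]) (auto simp: inner_add_left)
  qed
  ultimately show ?thesis
    by (simp add: convex_body_support_def)
qed

lemma convex_body_support_sum:
  assumes "finite I" "I \<noteq> {}" "\<And>i. i \<in> I \<Longrightarrow> \<exists>K. convex_body_support K (h i)"
  shows "\<exists>K. convex_body_support K (\<lambda>u. \<Sum>i\<in>I. h i u)"
  using assms
proof (induction I rule: finite_ne_induct)
  case (insert i I)
  then obtain K L where "convex_body_support K (h i)" "convex_body_support L (\<lambda>u. \<Sum>i\<in>I. h i u)"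
    by blast
  from convex_body_support_add[OF this] show ?case
    using insert.hyps by auto
qed auto

lemma convex_body_support_scale:
  assumes K: "convex_body_support K h" and "c > 0"
  shows "convex_body_support ((*\<^sub>R) c ` K) (\<lambda>u. c * h u)"
proof -
  have "interior ((*\<^sub>R) c ` K) = (*\<^sub>R) c ` interior K"
    using \<open>c > 0\<close> by (intro interior_injective_linear_image) (auto simp: inj_on_def)
  then show ?thesis
    using assms by (auto simp: convex_body_support_def compact_scaling convex_scaling)
qed

lemma orthogonal_matrix_inj:
  fixes A :: "real^'n^'n"
  assumes "orthogonal_matrix A"
  shows "inj ((*v) A)"
  using assms by (intro inj_on_inverseI[of _ "(*v) (transpose A)"])
    (simp add: matrix_vector_mul_assoc orthogonal_matrix_def)

lemma convex_body_support_orthogonal: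
  fixes A :: "real^'n^'n"
  assumes K: "convex_body_support K h" and A: "orthogonal_matrix A"
  shows "convex_body_support ((*v) A ` K) (\<lambda>u. h (transpose A *v u))"
proof -
  have "interior ((*v) A ` K) = (*v) A ` interior K"
    using A by (intro interior_injective_linear_image orthogonal_matrix_inj) auto
  moreover have "compact ((*v) A ` K)" "convex ((*v) A ` K)"
    using K by (auto simp: convex_body_support_def
        intro!: compact_continuous_image linear_continuous_on convex_linear_image)
  moreover have "transpose A *v u \<in> sphere 0 1" if "u \<in> sphere 0 1" for u
    using A that norm_orthogonal_matrix_vector[of "transpose A" u]
    by simp
  ultimately show ?thesis
    using K by (auto simp: convex_body_support_def inner_matrix_vector_transpose)
qed

text \<open>A point outside a convex body is cut off by a hyperplane, whose normal can be scaled to a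
  unit vector.\<close>

lemma convex_body_support_eq_halfspaces:
  assumes K: "convex_body_support K h"
  shows "K = {x. \<forall>u\<in>sphere 0 1. x \<bullet> u \<le> h u}"
proof (rule antisym[OF _ subsetI])
  fix z assume "z \<in> {x. \<forall>u\<in>sphere 0 1. x \<bullet> u \<le> h u}"
  then have z: "z \<bullet> u \<le> h u" if "norm u = 1" for u
    using that by simp
  show "z \<in> K"
  proof (rule ccontr)
    assume "z \<notin> K"
    then obtain a b where ab: "a \<bullet> z < b" "\<And>x. x \<in> K \<Longrightarrow> a \<bullet> x > b"
      using separating_hyperplane_closed_point[of K z] K
      by (auto simp: convex_body_support_def compact_imp_closed)
    have "K \<noteq> {}"
      using K by (auto simp: convex_body_support_def)
    then have "a \<noteq> 0"
      using ab by fastforce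
    \<comment> \<open>The separating normal \<open>a\<close> points towards \<open>K\<close>, so the outward one is its opposite.\<close>
    define u where "u = - (a /\<^sub>R norm a)"
    have "norm u = 1"
      using \<open>a \<noteq> 0\<close> by (simp add: u_def)
    then obtain x where x: "x \<in> K" "x \<bullet> u = h u"
      using K unfolding convex_body_support_def by (metis mem_sphere_0)
    have "a \<bullet> z < a \<bullet> x"
      using ab(1) ab(2)[OF x(1)] by simp
    then have "x \<bullet> u < z \<bullet> u"
      using \<open>a \<noteq> 0\<close> by (simp add: u_def inner_commute)
    then show False
      using z[OF \<open>norm u = 1\<close>] x by simp
  qed
next
  show "K \<subseteq> {x. \<forall>u\<in>sphere 0 1. x \<bullet> u \<le> h u}"
    using K by (auto simp: convex_body_support_def)
qed

section \<open>Surfaces and their support functions\<close>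

text \<open>A nonconstant linear functional attains its maximum over a body only on the boundary, so the
  boundary surface and the body have the same supporting planes.\<close>

lemma has_support_function_frontier:
  assumes K: "convex_body_support K h"
  shows "has_support_function (frontier K) h"
  unfolding has_support_function_def
proof (intro conjI ballI)
  show S: "closed_convex_surface (frontier K)"
    using K by (auto simp: closed_convex_surface_def convex_body_support_def)
  have sub: "frontier K \<subseteq> K"
    using K by (intro frontier_subset_closed) (auto simp: convex_body_support_def compact_imp_closed)
  fix u :: "real^3" assume u: "u \<in> sphere 0 1"
  have le: "\<And>x. x \<in> K \<Longrightarrow> x \<bullet> u \<le> h u"
    using K u by (auto simp: convex_body_support_def)
  obtain x where x: "x \<in> K" "x \<bullet> u = h u"
    using K u unfolding convex_body_support_def by blast
  have "x \<notin> interior K"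
  proof
    assume "x \<in> interior K"
    then obtain e where e: "e > 0" "cball x e \<subseteq> K"
      by (auto simp: mem_interior_cball)
    have "x + e *\<^sub>R u \<in> cball x e"
      using u e(1) by (simp add: dist_norm)
    then have "(x + e *\<^sub>R u) \<bullet> u \<le> h u"
      using e(2) le by blast
    moreover have "u \<bullet> u = 1"
      using u by (simp add: dot_square_norm)
    ultimately show False
      using x e(1) by (simp add: inner_add_left)
  qed
  then have "x \<in> frontier K"
    using x(1) closure_subset by (auto simp: frontier_def)
  then show "h u = support_function (frontier K) u"
    using support_function_tangent_plane[OF S, of u "h u"] x(2) le sub by auto
qed

text \<open>By compactness the body bounded by the surface has a touching point \<open>p u\<close> in every direction
  \<open>u\<close>.  The resulting function \<open>u \<mapsto> p u \<bullet> u\<close> also belongs to the boundary, by the preceding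
  lemma, so it agrees with the given one on the unit sphere.\<close>

lemma has_support_function_imp_body:
  assumes "has_support_function S h"
  obtains K where "S = frontier K" "convex_body_support K h"
proof -
  obtain K where K: "compact K" "convex K" "interior K \<noteq> {}" "S = frontier K"
    using assms by (auto simp: has_support_function_def closed_convex_surface_def)
  have "\<exists>x\<in>K. \<forall>y\<in>K. y \<bullet> u \<le> x \<bullet> u" for u
    using K interior_subset[of K]
    by (intro continuous_attains_sup) (auto intro!: continuous_intros)
  then obtain p where p: "\<And>u. p u \<in> K" "\<And>u y. y \<in> K \<Longrightarrow> y \<bullet> u \<le> p u \<bullet> u"
    by metis
  have body: "convex_body_support K (\<lambda>u. p u \<bullet> u)"
    using K p by (auto simp: convex_body_support_def)
  have "p u \<bullet> u = h u" if "u \<in> sphere 0 1" for u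
    using has_support_function_frontier[OF body] assms K(4) that
    by (auto simp: has_support_function_def)
  then have "convex_body_support K h"
    using body unfolding convex_body_support_def by metis
  with K(4) show ?thesis by (rule that)
qed

lemma has_support_function_unique:
  assumes "has_support_function S h" "has_support_function T h"
  shows "S = T"
proof -
  obtain K where K: "S = frontier K" "convex_body_support K h"
    using assms(1) by (rule has_support_function_imp_body)
  obtain L where L: "T = frontier L" "convex_body_support L h"
    using assms(2) by (rule has_support_function_imp_body)
  have "K = L"
    using convex_body_support_eq_halfspaces[OF K(2)] convex_body_support_eq_halfspaces[OF L(2)]
    by simp
  then show ?thesis
    by (simp add: K L)
qed

lemma has_support_function_cong:
  assumes "\<And>u. u \<in> sphere 0 1 \<Longrightarrow> h u = k u"
  shows "has_support_function S h \<longleftrightarrow> has_support_function S k"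
  using assms by (simp add: has_support_function_def)

lemma has_support_function_orthogonal:
  assumes S: "has_support_function S h" and A: "orthogonal_matrix A"
  shows "has_support_function ((*v) A ` S) (\<lambda>u. h (transpose A *v u))"
proof -
  obtain K where K: "S = frontier K" "convex_body_support K h"
    using S by (rule has_support_function_imp_body)
  have inj: "inj ((*v) A)"
    using A by (rule orthogonal_matrix_inj)
  have closed: "closed K" "closed ((*v) A ` K)"
    using K(2) convex_body_support_orthogonal[OF K(2) A]
    by (auto simp: convex_body_support_def compact_imp_closed)
  have "(*v) A ` S = frontier ((*v) A ` K)"
    using closed inj
    by (simp add: K(1) frontier_def interior_injective_linear_image image_set_diff)
  then show ?thesis
    using has_support_function_frontier[OF convex_body_support_orthogonal[OF K(2) A]] by simp
qed

lemma constant_width_iff: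
  assumes "has_support_function S h"
  shows "constant_width S w \<longleftrightarrow> (\<forall>u\<in>sphere 0 1. h u + h (- u) = w)"
  using assms by (simp add: constant_width_def has_support_function_def)

section \<open>Averaging over a group\<close>

theorem proposition7:
  fixes G :: "(real^3^3) set" and S0 :: "(real^3) set"
    and r0 r :: "real^3 \<Rightarrow> real" and w :: real
  assumes "subgroup G O3" and "discrete G"
    and "constant_width S0 w" and "has_support_function S0 r0"
    and "\<And>u. u \<in> sphere 0 1 \<Longrightarrow> r u = 1 / real (card G) * (\<Sum>g\<in>G. r0 (g *v u))"
  shows "finite G \<and>
         (\<exists>!S. has_support_function S r) \<and>
         (\<forall>S. has_support_function S r \<longrightarrow> constant_width S w \<and> invariant_under G S)"
proof -
  note G = subgroup_O3D[OF assms(1)]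
  note r = assms(5)
  have fin: "finite G"
    using assms(1,2) by (rule finite_discrete_subgroup_O3)
  have "G \<noteq> {}"
    using G(1) by auto
  with fin have card: "real (card G) > 0"
    by (simp add: card_gt_0_iff)
  have sphere: "g *v u \<in> sphere 0 1" if "g \<in> G" "u \<in> sphere 0 1" for g u
    using that G(2) by (simp add: norm_orthogonal_matrix_vector)

  obtain K0 where K0: "convex_body_support K0 r0"
    using assms(4) by (rule has_support_function_imp_body)
  have "\<exists>K. convex_body_support K (\<lambda>u. r0 (g *v u))" if "g \<in> G" for g
    using convex_body_support_orthogonal[OF K0, of "transpose g"] G(2)[OF that]
    by auto
  then obtain K where "convex_body_support K (\<lambda>u. \<Sum>g\<in>G. r0 (g *v u))"
    using convex_body_support_sum[OF fin \<open>G \<noteq> {}\<close>, of "\<lambda>g u. r0 (g *v u)"] by blast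
  from has_support_function_frontier[OF convex_body_support_scale[OF this, of "1 / real (card G)"]]
  have ex: "\<exists>S. has_support_function S r"
    using card has_support_function_cong[OF r] by auto

  have width: "constant_width S w" if S: "has_support_function S r" for S
    unfolding constant_width_iff[OF S]
  proof
    fix u :: "real^3" assume u: "u \<in> sphere 0 1"
    have "r u + r (- u) = 1 / real (card G) * (\<Sum>g\<in>G. r0 (g *v u) + r0 (- (g *v u)))"
      using u by (simp add: r sum.distrib distrib_left add_divide_distrib
          linear_neg[OF matrix_vector_mul_linear])
    also have "(\<Sum>g\<in>G. r0 (g *v u) + r0 (- (g *v u))) = (\<Sum>g\<in>G. w)"
      using assms(3) sphere[OF _ u] unfolding constant_width_iff[OF assms(4)]
      by (intro sum.cong) blast+
    finally show "r u + r (- u) = w"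
      using card by simp
  qed

  have inv: "r (transpose h *v u) = r u" if h: "h \<in> G" and u: "u \<in> sphere 0 1" for h u
  proof -
    have "(\<Sum>g\<in>G. r0 ((g ** transpose h) *v u)) = (\<Sum>g\<in>G. r0 (g *v u))"
      using h G(2)[OF h]
      by (intro sum.reindex_bij_witness[of _ "\<lambda>g. g ** h" "\<lambda>g. g ** transpose h"])
        (auto simp: G orthogonal_matrix_def simp flip: matrix_mul_assoc)
    then show ?thesis
      using u sphere[OF G(4)[OF h] u] by (simp add: r matrix_vector_mul_assoc del: transpose_matrix_vector)
  qed
  have "invariant_under G S" if S: "has_support_function S r" for S
    unfolding invariant_under_def
  proof
    fix h assume h: "h \<in> G"
    have "has_support_function ((*v) h ` S) (\<lambda>u. r (transpose h *v u))"
      using S G(2)[OF h] by (rule has_support_function_orthogonal)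
    then have "has_support_function ((*v) h ` S) r"
      using has_support_function_cong[of "\<lambda>u. r (transpose h *v u)" r] inv[OF h] by blast
    then show "(*v) h ` S = S"
      using S by (rule has_support_function_unique)
  qed
  with fin ex width show ?thesis
    using has_support_function_unique by blast
qed

end
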